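(* Let $n\ge1$ be a natural number. Define the double-indexed sequence $G_r(k)$ for integers $r,k\ge0$ by $G_r(0)=1$ for all $r$, and for $k\ge1$ $$G_r(k)=5\,(n-r-k)\,G_r(k-1)-2\,(n-2r-\delta(n-1))\,G_{r+1}(k-1).$$ Then $$\frac{G_0(\lfloor n/2\rfloor)}{(n-1)(n-2)\cdots(n-\lfloor n/2\rfloor)}=\begin{cases}F(n) & \text{if } n \text{ is odd},\\ L(n) & \text{if } n \text{ is even},\end{cases}$$ where $F$ is the Fibonacci sequence and $L$ is the Lucas sequence.
   Context: For a natural number $m$, $\delta(m)\in\{0,1\}$ denotes $m\bmod 2$. Empty products equal $1$. The Fibonacci sequence is $F(0)=0$, $F(1)=1$, $F(m+1)=F(m)+F(m-1)$; the Lucas sequence is $L(0)=2$, $L(1)=1$, $L(m+1)=L(m)+L(m-1)$. *)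

theory Defs
  imports Complex_Main "HOL-Number_Theory.Fib"
begin

fun lucas :: "nat \<Rightarrow> nat" where
  "lucas 0 = 2"
| "lucas (Suc 0) = 1"
| "lucas (Suc (Suc m)) = lucas (Suc m) + lucas m"

definition delta :: "nat \<Rightarrow> nat" where
  "delta m = m mod 2"

(* G n r k is G_r(k), whose recursion depends on n.  Integer-valued, because the factors
   n - r - k and n - 2r - delta (n - 1) can be negative; only the inner n - 1 is a
   subtraction of naturals, which is exact for n \<ge> 1. *)
fun G :: "nat \<Rightarrow> nat \<Rightarrow> nat \<Rightarrow> int" where
  "G n r 0 = 1"
| "G n r (Suc k) =
     5 * (int n - int r - int (Suc k)) * G n r k
     - 2 * (int n - 2 * int r - int (delta (n - 1))) * G n (Suc r) k"

end

theory Submission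
  imports Defs
begin

text \<open>
  The recursion sums over lattice paths: a step keeping \<open>r\<close> has weight \<open>5 (n - s)\<close>, depending only
  on \<open>s = r + k\<close>, and lowers \<open>s\<close>; a step raising \<open>r\<close> has a weight depending only on \<open>r\<close> and fixes \<open>s\<close>.
  So all paths with \<open>j\<close> steps of the second kind have the same weight, and there are \<open>k choose j\<close> of
  them. For \<open>k = n div 2\<close>, after division by the product, the coefficient of
  \<open>(-1)^j 5^(n div 2 - j)\<close> becomes Waring's \<open>n / (n - j) * (n - j choose j)\<close>, for both parities of
  \<open>n\<close>. With the golden ratio \<open>a\<close> and its conjugate \<open>b\<close>, one has \<open>(a - b)^2 = 5\<close> and \<open>a b = -1\<close>, and
  these sums are Waring's expansion of \<open>(a^n - b^n) / (a - b)\<close> (odd \<open>n\<close>) and \<open>a^n + b^n\<close> (even \<open>n\<close>);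
  they are identified through their recurrence, which matches
  \<open>F (n + 2) = L (n + 1) - F n\<close> and \<open>L (n + 2) = 5 F (n + 1) - L n\<close>.
\<close>

lemma G_eq_sum:
  "G n r k = (\<Sum>j\<le>k. int (k choose j) * (-2) ^ j * 5 ^ (k - j)
     * (\<Prod>s = r + j + 1..r + k. int n - int s)
     * (\<Prod>i = r..<r + j. int n - 2 * int i - int (delta (n - 1))))"
proof (induction k arbitrary: r)
  case 0
  then show ?case by simp
next
  case (Suc k)
  define P where "P a b = (\<Prod>s = a + 1..b. int n - int s)" for a b :: nat
  define Q where "Q a b = (\<Prod>i = a..<b. int n - 2 * int i - int (delta (n - 1)))" for a b :: nat
  have P_Suc: "P a (Suc b) = (int n - int (Suc b)) * P a b" if "a \<le> b" for a b
    using that by (simp add: P_def mult.commute)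
  have Q_Suc: "Q a b = (int n - 2 * int a - int (delta (n - 1))) * Q (Suc a) b" if "a < b" for a b
    using that unfolding Q_def by (rule prod.atLeast_Suc_lessThan)
  have IH: "G n r k = (\<Sum>j\<le>k. int (k choose j) * (-2) ^ j * 5 ^ (k - j) * P (r + j) (r + k) * Q r (r + j))" for r
    using Suc.IH[of r] by (simp add: P_def Q_def)
  \<comment> \<open>\<open>f j\<close> is the weight of one path of length \<open>Suc k\<close> with
    \<open>j\<close> raising steps. The binomial is kept apart, so that a first step of either kind
    leaves the same weights and Pascal's rule merges the two sums.\<close>
  define f where "f j = (-2) ^ j * 5 ^ (Suc k - j) * P (r + j) (r + Suc k) * Q r (r + j)" for j
  have stay: "5 * (int n - int r - int (Suc k)) * G n r k = (\<Sum>j\<le>k. int (k choose j) * f j)"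
    unfolding IH sum_distrib_left f_def
    by (intro sum.cong refl) (simp add: P_Suc Suc_diff_le algebra_simps)
  have move: "- 2 * (int n - 2 * int r - int (delta (n - 1))) * G n (Suc r) k
      = (\<Sum>j\<le>k. int (k choose j) * f (Suc j))"
    unfolding IH sum_distrib_left f_def
    by (intro sum.cong refl) (simp add: Q_Suc algebra_simps)
  have "(\<Sum>j\<le>Suc k. int (Suc k choose j) * f j)
      = f 0 + (\<Sum>j\<le>k. int (k choose Suc j) * f (Suc j)) + (\<Sum>j\<le>k. int (k choose j) * f (Suc j))"
    by (simp add: sum.atMost_Suc_shift sum.distrib algebra_simps del: sum.atMost_Suc)
  also have "f 0 + (\<Sum>j\<le>k. int (k choose Suc j) * f (Suc j)) = (\<Sum>j\<le>Suc k. int (k choose j) * f j)"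
    by (simp add: sum.atMost_Suc_shift del: sum.atMost_Suc)
  also have "\<dots> = (\<Sum>j\<le>k. int (k choose j) * f j)"
    by simp
  finally have "(\<Sum>j\<le>Suc k. int (Suc k choose j) * f j)
      = 5 * (int n - int r - int (Suc k)) * G n r k
        + - 2 * (int n - 2 * int r - int (delta (n - 1))) * G n (Suc r) k"
    unfolding stay move .
  then have "G n r (Suc k) = (\<Sum>j\<le>Suc k. int (Suc k choose j) * f j)"
    by (simp only: G.simps diff_conv_add_uminus mult_minus_left)
  then show ?case
    by (simp add: f_def P_def Q_def mult.assoc del: G.simps sum.atMost_Suc)
qed

text \<open>The value 2 at \<open>(0, 0)\<close> keeps the recurrence valid at \<open>(2, 1)\<close>, where \<open>n / (n - j)\<close> would be \<open>0 / 0\<close>.\<close>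
fun waring :: "nat \<Rightarrow> nat \<Rightarrow> nat" where
  "waring 0 j = (if j = 0 then 2 else 0)"
| "waring (Suc 0) j = (if j = 0 then 1 else 0)"
| "waring (Suc (Suc n)) 0 = 1"
| "waring (Suc (Suc n)) (Suc j) = waring (Suc n) (Suc j) + waring n j"

lemma waring_zero: "n \<ge> 1 \<Longrightarrow> waring n 0 = 1"
  by (cases "(n, 0::nat)" rule: waring.cases) auto

lemma waring_eq_0: "n < 2 * j \<Longrightarrow> waring n j = 0"
  by (induction n j rule: waring.induct) auto

text \<open>Waring's coefficient \<open>n / (n - j) * (n - j choose j)\<close> in division-free
  form, so that the recurrence can be checked over the naturals.\<close>

lemma waring_fact:
  assumes "n \<ge> 1" "2 * j \<le> n"
  shows "waring n j * fact j * fact (n - 2 * j) = n * fact (n - j - 1)"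
  using assms
proof (induction n j rule: waring.induct)
  case (4 n j)
  show ?case
  proof (cases "n = 0")
    case True
    with 4 show ?thesis by simp
  next
    case False
    have a: "waring n j * fact j * fact (n - 2 * j) = n * fact (n - j - 1)"
      using 4 False by simp
    have b: "waring (Suc n) (Suc j) * fact (Suc j) * fact (n - 2 * j)
        = (n + 1) * fact (n - j - 1) * (n - 2 * j)"
    \<comment> \<open>At \<open>n = 2 * j\<close> the induction hypothesis is out of range, but both
      sides vanish.\<close>
    proof (cases "n = 2 * j")
      case True
      then show ?thesis by (simp add: waring_eq_0)
    next
      case False
      then obtain d where d: "n = 2 * j + Suc d"
        using 4 less_imp_Suc_add[of "2 * j" n] by auto
      have "waring (Suc n) (Suc j) * fact (Suc j) * fact d = (n + 1) * fact (n - j - 1)"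
        using 4(1) d by simp
      moreover have "fact (n - 2 * j) = fact d * (n - 2 * j)"
        by (simp add: d)
      ultimately show ?thesis
        by (simp only: mult.assoc[symmetric])
    qed
    obtain d where d: "n = 2 * j + d"
      using 4 le_Suc_ex by auto
    have f: "fact (n - j) = (n - j) * (fact (n - j - 1) :: nat)"
      using False 4 by (subst fact_num_eq_if) auto
    have "waring (Suc (Suc n)) (Suc j) * fact (Suc j) * fact (n - 2 * j)
        = (n + 1) * fact (n - j - 1) * (n - 2 * j) + (j + 1) * (n * fact (n - j - 1))"
      using a b by (simp add: algebra_simps)
    also have "\<dots> = (n + 2) * ((n - j) * fact (n - j - 1))"
      unfolding d by (simp add: algebra_simps)
    finally show ?thesis
      using f by simp
  qed
next
  case (2 j)
  then have "j = 0" by simp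
  then show ?case by simp
qed auto

definition waring_sum :: "nat \<Rightarrow> int" where
  "waring_sum n = (\<Sum>j\<le>n div 2. (-1) ^ j * int (waring n j) * 5 ^ (n div 2 - j))"

text \<open>Shifting \<open>j\<close> in the recurrence of \<open>waring\<close> produces the minus
  sign. The exponent \<open>n div 2\<close> grows from \<open>Suc n\<close> to
  \<open>Suc (Suc n)\<close> only for even \<open>n\<close>, which gives the factor 5.\<close>

lemma waring_sum_Suc_Suc:
  "waring_sum (Suc (Suc n)) = (if even n then 5 else 1) * waring_sum (Suc n) - waring_sum n"
proof -
  define h where "h = n div 2"
  \<comment> \<open>The coefficients of \<open>Suc n\<close>, with the bound and the exponents of
    \<open>Suc (Suc n)\<close>.\<close>
  define S where "S = (\<Sum>j\<le>Suc h. (-1) ^ j * int (waring (Suc n) j) * 5 ^ (Suc h - j))"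
  have "waring_sum (Suc (Suc n)) = S - waring_sum n"
    by (simp add: waring_sum_def S_def h_def sum.atMost_Suc_shift sum.distrib sum_subtractf
        sum_negf waring_zero algebra_simps del: sum.atMost_Suc)
  moreover have "S = (if even n then 5 else 1) * waring_sum (Suc n)"
  proof (cases "even n")
    case True
    then have "waring (Suc n) (Suc h) = 0" "Suc n div 2 = h"
      by (auto simp: h_def intro!: waring_eq_0)
    with True show ?thesis
      by (simp add: S_def waring_sum_def sum_distrib_left Suc_diff_le algebra_simps)
  next
    case False
    then have "Suc n div 2 = Suc h"
      by (auto simp: h_def elim: oddE)
    with False show ?thesis
      by (simp add: S_def waring_sum_def)
  qed
  ultimately show ?thesis by simp
qed

lemma lucas_Suc_eq_fib: "lucas (Suc n) = fib n + fib (Suc (Suc n))"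
  by (induction n rule: fib.induct) auto

lemma lucas_eq_fib: "int (lucas n) = 2 * int (fib (Suc n)) - int (fib n)"
  by (cases n) (simp_all add: lucas_Suc_eq_fib)

lemma waring_sum_eq: "waring_sum n = (if odd n then int (fib n) else int (lucas n))"
proof (induction n rule: fib.induct)
  case (3 n)
  then show ?case
    by (auto simp: waring_sum_Suc_Suc lucas_eq_fib)
qed (simp_all add: waring_sum_def)

text \<open>Passing from \<open>j\<close> to \<open>Suc j\<close> contributes
  \<open>(n - 2 * j) * (n - 2 * j - 1)\<close>, the next two factors of the falling factorial of
  \<open>n\<close>. The binomial supplies the even one and the product the odd one;
  \<open>delta\<close> adjusts the latter to the parity of \<open>n\<close>.\<close>

lemma choose_prod_fact:
  fixes n j :: nat
  assumes "n \<ge> 1" "2 * j \<le> n"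
  shows "int (n div 2 choose j) * 2 ^ j * (\<Prod>i<j. int n - 2 * int i - int (delta (n - 1)))
     * fact j * fact (n - 2 * j) = fact n"
  using assms(2)
proof (induction j)
  case 0
  then show ?case by simp
next
  case (Suc j)
  define C where "C = int (n div 2 choose j) * 2 ^ j * (\<Prod>i<j. int n - 2 * int i - int (delta (n - 1)))
     * fact j"
  have IH: "C * fact (n - 2 * j) = fact n"
    using Suc unfolding C_def by simp
  obtain d where d: "n = Suc (Suc (2 * j + d))"
    using Suc.prems le_Suc_ex[of "2 * Suc j" n] by auto
  have choose: "int (Suc j) * int (n div 2 choose Suc j) = int (n div 2 - j) * int (n div 2 choose j)"
    by (metis binomial_absorb_comp binomial_absorption mult.commute of_nat_mult)
  have half: "2 * int (n div 2 - j) * (int n - 2 * int j - int (delta (n - 1)))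
      = int (Suc (Suc d)) * int (Suc d)"
  proof (cases "even d")
    case True
    then have "delta (n - 1) = 1" "n div 2 - j = Suc (d div 2)"
      by (auto simp: delta_def d mod_2_eq_odd elim!: evenE)
    with True show ?thesis
      by (auto simp: d algebra_simps elim!: evenE)
  next
    case False
    then have "delta (n - 1) = 0" "n div 2 - j = Suc (d div 2)"
      by (auto simp: delta_def d mod_2_eq_odd elim!: oddE)
    with False show ?thesis
      by (auto simp: d algebra_simps elim!: oddE)
  qed
  have "int (n div 2 choose Suc j) * 2 ^ Suc j
      * (\<Prod>i<Suc j. int n - 2 * int i - int (delta (n - 1))) * fact (Suc j) * fact (n - 2 * Suc j)
    = (int (Suc j) * int (n div 2 choose Suc j)) * 2 ^ Suc j
      * (\<Prod>i<Suc j. int n - 2 * int i - int (delta (n - 1))) * fact j * fact d"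
    by (simp add: d algebra_simps)
  also have "\<dots> = C * (2 * int (n div 2 - j) * (int n - 2 * int j - int (delta (n - 1)))) * fact d"
    unfolding choose C_def by (simp add: ac_simps)
  also have "\<dots> = C * fact (n - 2 * j)"
    unfolding half by (simp add: d algebra_simps)
  finally show ?case
    using IH by simp
qed

lemma prod_mult_fact:
  fixes n j :: nat
  assumes "j < n"
  shows "(\<Prod>s = 1..j. int n - int s) * fact (n - j - 1) = fact (n - 1)"
  using assms
proof (induction j)
  case (Suc j)
  then obtain d where d: "n = Suc (Suc j + d)"
    by (auto dest: less_imp_Suc_add)
  have IH: "(\<Prod>s = 1..j. int n - int s) * fact (Suc d) = fact (n - 1)"
    using Suc d by simp
  have "(int n - int (Suc j)) * fact (n - Suc j - 1) = fact (Suc d)"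
    by (simp add: d)
  moreover have "(\<Prod>s = 1..Suc j. int n - int s) = (\<Prod>s = 1..j. int n - int s) * (int n - int (Suc j))"
    by simp
  ultimately show ?case
    using IH by (simp only: mult.assoc)
qed simp

text \<open>Both sides become \<open>fact n\<close> when multiplied by
  \<open>fact j * fact (n - 2 * j)\<close>, which can be cancelled.\<close>

lemma choose_prod_eq_waring:
  fixes n j :: nat
  assumes "n \<ge> 1" "2 * j \<le> n"
  shows "int (n div 2 choose j) * 2 ^ j * (\<Prod>i<j. int n - 2 * int i - int (delta (n - 1)))
    = int (waring n j) * (\<Prod>s = 1..j. int n - int s)"
proof -
  define P where "P = (\<Prod>s = 1..j. int n - int s)"
  have waring: "int (waring n j) * fact j * fact (n - 2 * j) = int n * fact (n - j - 1)"
    using arg_cong[OF waring_fact[OF assms], of int] by simp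
  have "int (waring n j) * P * (fact j * fact (n - 2 * j))
      = (int (waring n j) * fact j * fact (n - 2 * j)) * P"
    by (simp add: ac_simps)
  also have "\<dots> = int n * (P * fact (n - j - 1))"
    unfolding waring by (simp add: ac_simps)
  also have "P * fact (n - j - 1) = fact (n - 1)"
    unfolding P_def using assms by (intro prod_mult_fact) auto
  also have "int n * fact (n - 1) = fact n"
    using assms by (intro fact_reduce[symmetric]) auto
  finally have "int (n div 2 choose j) * 2 ^ j
      * (\<Prod>i<j. int n - 2 * int i - int (delta (n - 1))) * (fact j * fact (n - 2 * j))
    = int (waring n j) * P * (fact j * fact (n - 2 * j))"
    using choose_prod_fact[OF assms] by (simp only: mult.assoc)
  moreover have "fact j * fact (n - 2 * j) \<noteq> (0 :: int)"
    by simp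
  ultimately show ?thesis
    unfolding P_def by (rule mult_right_cancel[THEN iffD1, rotated])
qed

lemma G_eq_waring_sum:
  assumes "n \<ge> 1"
  shows "G n 0 (n div 2) = waring_sum n * (\<Prod>s = 1..n div 2. int n - int s)"
  unfolding G_eq_sum waring_sum_def sum_distrib_right
proof (rule sum.cong)
  fix j assume "j \<in> {..n div 2}"
  then have j: "j \<le> n div 2" "2 * j \<le> n" by auto
  \<comment> \<open>The factors up to \<open>j\<close> come with the Waring coefficient, the others
    from the steps that keep \<open>r\<close>; together they form the full denominator, the same for
    every \<open>j\<close>.\<close>
  have split: "(\<Prod>s = 1..n div 2. int n - int s)
      = (\<Prod>s = 1..j. int n - int s) * (\<Prod>s = j + 1..n div 2. int n - int s)"
    using prod.ub_add_nat[of 1 j "\<lambda>s. int n - int s" "n div 2 - j"] j by simp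
  have minus2: "(-2 :: int) ^ j = (-1) ^ j * 2 ^ j"
    by (rule power_minus)
  show "int (n div 2 choose j) * (-2) ^ j * 5 ^ (n div 2 - j)
      * (\<Prod>s = 0 + j + 1..0 + n div 2. int n - int s)
      * (\<Prod>i = 0..<0 + j. int n - 2 * int i - int (delta (n - 1)))
    = (-1) ^ j * int (waring n j) * 5 ^ (n div 2 - j) * (\<Prod>s = 1..n div 2. int n - int s)"
    unfolding split minus2
    using arg_cong[OF choose_prod_eq_waring[OF assms j(2)],
        of "\<lambda>x. (-1) ^ j * 5 ^ (n div 2 - j) * (\<Prod>s = j + 1..n div 2. int n - int s) * x"]
    by (simp only: ac_simps lessThan_atLeast0 add_0)
qed simp

theorem theorem18:
  fixes n :: nat
  assumes "n \<ge> 1"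
  shows "(of_int (G n 0 (n div 2)) :: rat) / (\<Prod>i = 1..n div 2. of_nat n - of_nat i)
    = (if odd n then of_nat (fib n) else of_nat (lucas n))"
proof -
  \<comment> \<open>No factor vanishes, since \<open>n div 2 < n\<close> for
    \<open>n \<ge> 1\<close>.\<close>
  have "(\<Prod>i = 1..n div 2. of_nat n - of_nat i) \<noteq> (0 :: rat)"
    by (auto simp: assms)
  moreover have "(of_int (G n 0 (n div 2)) :: rat)
      = of_int (waring_sum n) * (\<Prod>i = 1..n div 2. of_nat n - of_nat i)"
    by (simp add: G_eq_waring_sum[OF assms])
  ultimately show ?thesis
    by (simp add: waring_sum_eq)
qed

end
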